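(* Suppose $L_1, \ldots, L_{n+1}$ are exchangeable non-negative random variables. Then for any positive $\alpha$, $$P\left\{ \frac{L_{n+1}}{\frac{L_1 + \cdots + L_n}{n}} \geq \frac{1}{\alpha}\left(\frac{1}{1 + \frac{1 - 1/\alpha}{n}}\right)\right\} \leq \alpha.$$
   Context: Random variables $L_1, \ldots, L_{n+1}$ are exchangeable if their joint distribution is unchanged under permutations: $(L_1, \ldots, L_{n+1})$ and $(L_{\sigma(1)}, \ldots, L_{\sigma(n+1)})$ have the same distribution for every permutation $\sigma$ of $\{1, \ldots, n+1\}$. $P$ denotes probability.
   Formalization: Proved for α ≥ 1/(n+1), not every positive α: for smaller α the threshold n/((n+1)α−1) is negative and the claim fails (all L_i = 1 gives probability 1). At α = 1/(n+1) the threshold is read as +∞; the ratio is +∞ when only L_{n+1} is nonzero, and 0/0 counts as 0. *)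

theory Defs
  imports "HOL-Probability.Probability" "HOL-Combinatorics.Permutations"
begin

text \<open>
  Measurability is part of the definition because \<^const>\<open>distr\<close> carries no information
  about non-measurable maps. The joint law lives on the product sigma-algebra over the
  index set \<open>I\<close>, and permutations of \<open>I\<close> are functions fixing everything outside \<open>I\<close>.
\<close>

definition exchangeable :: "'a measure \<Rightarrow> 'i set \<Rightarrow> ('i \<Rightarrow> 'a \<Rightarrow> real) \<Rightarrow> bool" where
  "exchangeable M I X \<longleftrightarrow>
     (\<forall>i\<in>I. X i \<in> borel_measurable M) \<and>
     (\<forall>\<sigma>. \<sigma> permutes I \<longrightarrow>
        distr M (Pi\<^sub>M I (\<lambda>_. borel)) (\<lambda>\<omega>. \<lambda>i\<in>I. X (\<sigma> i) \<omega>) =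
        distr M (Pi\<^sub>M I (\<lambda>_. borel)) (\<lambda>\<omega>. \<lambda>i\<in>I. X i \<omega>))"

text \<open>
  The two sides of the inequality are formed in \<^typ>\<open>ereal\<close>, where \<open>x / 0 = \<infinity>\<close> for
  \<open>x > 0\<close> and \<open>0 / 0 = 0\<close>. Thus the ratio is infinite if only the last variable is nonzero
  (over \<^typ>\<open>real\<close> it would be 0, which would drop this case from the event), and is 0 if all
  variables vanish. The threshold is \<open>n / ((n + 1) * \<alpha> - 1)\<close>, and is infinite at
  \<open>\<alpha> = 1 / (n + 1)\<close>.
\<close>

definition loss_ratio :: "nat \<Rightarrow> (nat \<Rightarrow> 'a \<Rightarrow> real) \<Rightarrow> 'a \<Rightarrow> ereal" where
  "loss_ratio n L \<omega> = ereal (L (n + 1) \<omega>) / ereal ((\<Sum>i=1..n. L i \<omega>) / real n)"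

definition ratio_threshold :: "nat \<Rightarrow> real \<Rightarrow> ereal" where
  "ratio_threshold n \<alpha> = ereal (1 / \<alpha>) * (1 / ereal (1 + (1 - 1 / \<alpha>) / real n))"

end

theory Submission imports Defs begin

text \<open>
  Let \<open>S\<close> be the sum of all \<open>n + 1\<close> variables. Clearing denominators turns the event into
  \<open>S > 0\<close> and \<open>S \<le> (n + 1) \<alpha> L\<^sub>n\<^sub>+\<^sub>1\<close>, that is, the last variable takes at least the fraction
  \<open>1 / ((n + 1) \<alpha>)\<close> of the total. At most \<open>(n + 1) \<alpha>\<close> of the variables can do so at once, and
  by exchangeability each of the \<open>n + 1\<close> of them does so with the same probability.
\<close>

text \<open>Turns the equality of pushforward measures into an equality of probabilities on
  \<open>M\<close>, the form in which exchangeability is applied to the share events below.\<close>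

lemma exchangeable_measure_permute:
  assumes "exchangeable M I X" "\<sigma> permutes I" "C \<in> sets (Pi\<^sub>M I (\<lambda>_. borel))"
  shows "measure M {\<omega> \<in> space M. (\<lambda>i\<in>I. X (\<sigma> i) \<omega>) \<in> C} =
         measure M {\<omega> \<in> space M. (\<lambda>i\<in>I. X i \<omega>) \<in> C}"
proof -
  have X: "X i \<in> borel_measurable M" if "i \<in> I" for i
    using assms(1) that by (simp add: exchangeable_def)
  have law: "measure M {\<omega> \<in> space M. (\<lambda>i\<in>I. X (\<tau> i) \<omega>) \<in> C} =
      measure (distr M (Pi\<^sub>M I (\<lambda>_. borel)) (\<lambda>\<omega>. \<lambda>i\<in>I. X (\<tau> i) \<omega>)) C"
    if "\<tau> permutes I" for \<tau>
  proof -
    have "(\<lambda>\<omega>. \<lambda>i\<in>I. X (\<tau> i) \<omega>) \<in> measurable M (Pi\<^sub>M I (\<lambda>_. borel))"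
      by (intro measurable_restrict X) (simp add: permutes_in_image that)
    then show ?thesis
      using assms(3) by (simp add: measure_distr vimage_def Int_def conj_commute)
  qed
  show ?thesis
    using law[OF assms(2)] law[OF permutes_id] assms(1,2) by (simp add: exchangeable_def)
qed

text \<open>A pointwise Markov bound: for a positive total, an index that counts has
  \<open>c * x i / sum x I\<close> at least 1, any other has it at least 0, and these quotients add
  up to \<open>c\<close>. For a nonpositive total no index counts.\<close>

lemma sum_indicator_share_le:
  fixes x :: "'i \<Rightarrow> real"
  assumes "finite I" "\<And>i. i \<in> I \<Longrightarrow> 0 \<le> x i" "0 \<le> c"
  shows "(\<Sum>i\<in>I. of_bool (0 < sum x I \<and> sum x I \<le> c * x i)) \<le> c"
proof (cases "0 < sum x I")
  case True
  have "(\<Sum>i\<in>I. of_bool (0 < sum x I \<and> sum x I \<le> c * x i)) \<le> (\<Sum>i\<in>I. c * x i / sum x I)"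
    using True assms by (intro sum_mono) (auto simp: of_bool_def)
  also have "\<dots> = c"
    using True by (simp flip: sum_divide_distrib sum_distrib_left)
  finally show ?thesis .
next
  case False
  then show ?thesis using assms by simp
qed

text \<open>Double counting: the left side is the sum of the equal probabilities of the events
  \<open>B j\<close>, hence the expected number of them that occur, and that number is almost surely
  at most \<open>c\<close>.\<close>

lemma (in prob_space) exchangeable_prob_share_le:
  fixes X :: "'i \<Rightarrow> 'a \<Rightarrow> real"
  assumes fin: "finite I" and exch: "exchangeable M I X"
    and nonneg: "\<And>i. i \<in> I \<Longrightarrow> AE \<omega> in M. 0 \<le> X i \<omega>"
    and c: "0 \<le> c" and k: "k \<in> I"
  shows "real (card I) * \<P>(\<omega> in M. 0 < (\<Sum>i\<in>I. X i \<omega>) \<and> (\<Sum>i\<in>I. X i \<omega>) \<le> c * X k \<omega>) \<le> c"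
proof -
  define B where "B j = {\<omega> \<in> space M. 0 < (\<Sum>i\<in>I. X i \<omega>) \<and> (\<Sum>i\<in>I. X i \<omega>) \<le> c * X j \<omega>}" for j
  have [measurable]: "X i \<in> borel_measurable M" if "i \<in> I" for i
    using exch that by (simp add: exchangeable_def)
  have B: "B j \<in> events" if "j \<in> I" for j
    using that unfolding B_def by measurable
  have same: "prob (B j) = prob (B k)" if j: "j \<in> I" for j
  proof -
    \<comment> \<open>Swapping \<open>j\<close> and \<open>k\<close> preserves the total, so
      \<open>B j\<close> and \<open>B k\<close> are preimages of the same set \<open>?C\<close>
      under the swapped and the original tuple.\<close>
    let ?\<sigma> = "Transposition.transpose j k"
    let ?C = "{x \<in> space (Pi\<^sub>M I (\<lambda>_. borel :: real measure)).
      0 < (\<Sum>i\<in>I. x i) \<and> (\<Sum>i\<in>I. x i) \<le> c * x k}"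
    have \<sigma>: "?\<sigma> permutes I" using j k by (rule permutes_swap_id)
    have C: "?C \<in> sets (Pi\<^sub>M I (\<lambda>_. borel))"
    proof -
      have comp: "(\<lambda>x. x i) \<in> borel_measurable (Pi\<^sub>M I (\<lambda>_. borel :: real measure))"
        if "i \<in> I" for i
        using that by (rule measurable_component_singleton)
      show ?thesis
        by (intro sets.sets_Collect_conj borel_measurable_less borel_measurable_le
            borel_measurable_sum borel_measurable_times borel_measurable_const comp k)
    qed
    have "(\<Sum>i\<in>I. X (?\<sigma> i) \<omega>) = (\<Sum>i\<in>I. X i \<omega>)" for \<omega>
      using sum.permute[OF \<sigma>, of "\<lambda>i. X i \<omega>"] by (simp add: o_def)
    then have "B j = {\<omega> \<in> space M. (\<lambda>i\<in>I. X (?\<sigma> i) \<omega>) \<in> ?C}"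
      using k by (auto simp: B_def space_PiM)
    moreover have "B k = {\<omega> \<in> space M. (\<lambda>i\<in>I. X i \<omega>) \<in> ?C}"
      using k by (auto simp: B_def space_PiM)
    ultimately show ?thesis
      using exchangeable_measure_permute[OF exch \<sigma> C] by simp
  qed
  have "real (card I) * prob (B k) = (\<Sum>j\<in>I. prob (B j))"
    using same by simp
  also have "\<dots> = expectation (\<lambda>\<omega>. \<Sum>j\<in>I. indicator (B j) \<omega>)"
    using B by (subst Bochner_Integration.integral_sum)
      (auto simp: integrable_indicator_iff less_top[symmetric])
  also have "\<dots> \<le> c"
  proof (rule integral_le_const)
    show "integrable M (\<lambda>\<omega>. \<Sum>j\<in>I. indicator (B j) \<omega> :: real)"
      using B by (intro Bochner_Integration.integrable_sum)
        (auto simp: integrable_indicator_iff less_top[symmetric])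
    have "AE \<omega> in M. \<forall>i\<in>I. 0 \<le> X i \<omega>"
      using nonneg fin by (simp add: AE_finite_all)
    then show "AE \<omega> in M. (\<Sum>j\<in>I. indicator (B j) \<omega>) \<le> c"
    proof (eventually_elim, goal_cases)
      case (1 \<omega>)
      have "(\<Sum>j\<in>I. indicator (B j) \<omega> :: real) \<le>
          (\<Sum>j\<in>I. of_bool (0 < (\<Sum>i\<in>I. X i \<omega>) \<and> (\<Sum>i\<in>I. X i \<omega>) \<le> c * X j \<omega>))"
        by (intro sum_mono) (auto simp: B_def indicator_def)
      also have "\<dots> \<le> c"
        using 1 fin c by (intro sum_indicator_share_le) auto
      finally show ?case .
    qed
  qed
  finally show ?thesis by (simp add: B_def)
qed

text \<open>With \<open>A\<close> the sum of the first \<open>n\<close> values, \<open>l\<close> the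
  last one and \<open>d = (n + 1) * \<alpha> - 1\<close>, the ratio is \<open>n * l / A\<close>, the
  threshold is \<open>n / d\<close>, and the share condition reads \<open>A \<le> d * l\<close>. The
  lower bound on \<alpha> makes \<open>d\<close> nonnegative, so cross-multiplying keeps the
  direction.\<close>

lemma loss_ratio_ge_threshold_imp_share:
  assumes n: "n \<ge> 1" and \<alpha>: "\<alpha> > 0" "\<alpha> \<ge> 1 / (real n + 1)"
    and nonneg: "\<And>i. i \<in> {1..n + 1} \<Longrightarrow> 0 \<le> L i \<omega>"
    and ge: "loss_ratio n L \<omega> \<ge> ratio_threshold n \<alpha>"
  shows "0 < (\<Sum>i\<in>{1..n + 1}. L i \<omega>) \<and> (\<Sum>i\<in>{1..n + 1}. L i \<omega>) \<le> (real n + 1) * \<alpha> * L (n + 1) \<omega>"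
proof -
  define A where "A = (\<Sum>i=1..n. L i \<omega>)"
  define l where "l = L (n + 1) \<omega>"
  define d where "d = (real n + 1) * \<alpha> - 1"
  have A: "0 \<le> A" unfolding A_def using nonneg by (intro sum_nonneg) auto
  have l: "0 \<le> l" unfolding l_def using nonneg by simp
  have d: "0 \<le> d" using \<alpha> by (simp add: d_def field_simps)
  have S: "(\<Sum>i\<in>{1..n + 1}. L i \<omega>) = A + l" by (simp add: A_def l_def)
  have den: "1 + (1 - 1 / \<alpha>) / real n = d / (real n * \<alpha>)"
    using n \<alpha> by (simp add: d_def field_simps)
  have thr: "ratio_threshold n \<alpha> = (if d = 0 then \<infinity> else ereal (real n / d))"
    using n \<alpha> by (auto simp: ratio_threshold_def den divide_ereal_def one_ereal_def simp flip: zero_ereal_def)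
  have "loss_ratio n L \<omega> = ereal l / ereal (A / real n)"
    by (simp add: loss_ratio_def A_def l_def)
  then have ratio: "loss_ratio n L \<omega> =
      (if A = 0 then if l = 0 then 0 else \<infinity> else ereal (l * real n / A))"
    using n A l by (auto simp: divide_ereal_def divide_inverse simp flip: zero_ereal_def)
  have "0 < A + l \<and> A \<le> d * l"
  proof (cases "A = 0")
    case True
    \<comment> \<open>If \<open>l\<close> vanished too, the ratio would be \<open>0 / 0 = 0\<close>,
      below a threshold that is positive or infinite.\<close>
    with ge have "l \<noteq> 0"
      using n d by (auto simp: thr ratio divide_le_0_iff split: if_splits)
    with True l d show ?thesis by simp
  next
    case False
    with A have "0 < A" by simp
    \<comment> \<open>The ratio is finite here, so the threshold below it is finite as well, which
      excludes \<open>d = 0\<close>.\<close>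
    moreover from ge False have "d \<noteq> 0" "real n / d \<le> l * real n / A"
      by (auto simp: thr ratio split: if_splits)
    ultimately show ?thesis
      using n d l by (simp add: field_simps)
  qed
  then show ?thesis
    unfolding S l_def[symmetric] by (simp add: d_def algebra_simps)
qed

theorem corollary1p1:
  fixes M :: "'a measure" and L :: "nat \<Rightarrow> 'a \<Rightarrow> real" and n :: nat and \<alpha> :: real
  assumes "prob_space M"
    and "n \<ge> 1"
    and "exchangeable M {1..n + 1} L"
    and "\<And>i. i \<in> {1..n + 1} \<Longrightarrow> AE \<omega> in M. 0 \<le> L i \<omega>"
    and "\<alpha> > 0"
    and "\<alpha> \<ge> 1 / (real n + 1)"
  shows "\<P>(\<omega> in M. loss_ratio n L \<omega> \<ge> ratio_threshold n \<alpha>) \<le> \<alpha>"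
proof -
  interpret prob_space M by fact
  let ?S = "\<lambda>\<omega>. \<Sum>i\<in>{1..n + 1}. L i \<omega>"
  let ?B = "{\<omega> \<in> space M. 0 < ?S \<omega> \<and> ?S \<omega> \<le> (real n + 1) * \<alpha> * L (n + 1) \<omega>}"
  have meas: "L i \<in> borel_measurable M" if "i \<in> {1..n + 1}" for i
    using assms(3) that by (simp add: exchangeable_def)
  have [measurable]: "?S \<in> borel_measurable M"
    by (intro borel_measurable_sum meas)
  have [measurable]: "L (n + 1) \<in> borel_measurable M"
    by (intro meas) simp
  have "?B \<in> events" by measurable
  moreover have "AE \<omega> in M. \<forall>i\<in>{1..n + 1}. 0 \<le> L i \<omega>"
    using assms(4) by (intro AE_finite_allI) auto
  \<comment> \<open>Nonnegativity is only almost sure, hence so is the inclusion of events;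
    monotonicity of the measure then asks for measurability of the larger event
    \<open>?B\<close>.\<close>
  then have "AE \<omega> in M. \<omega> \<in> {\<omega> \<in> space M. loss_ratio n L \<omega> \<ge> ratio_threshold n \<alpha>} \<longrightarrow> \<omega> \<in> ?B"
  proof (eventually_elim, intro impI, goal_cases)
    case (1 \<omega>)
    then show ?case
      using loss_ratio_ge_threshold_imp_share[OF assms(2,5,6), of L \<omega>] by simp
  qed
  ultimately have "\<P>(\<omega> in M. loss_ratio n L \<omega> \<ge> ratio_threshold n \<alpha>) \<le> prob ?B"
    by (intro finite_measure_mono_AE)
  \<comment> \<open>The index set has \<open>n + 1\<close> elements, the same factor as in
    \<open>c = (n + 1) * \<alpha>\<close>, so it cancels.\<close>
  moreover have "(real n + 1) * prob ?B \<le> (real n + 1) * \<alpha>"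
    using exchangeable_prob_share_le[OF _ assms(3,4), of "(real n + 1) * \<alpha>" "n + 1"] assms(5)
    by (simp add: add.commute)
  then have "prob ?B \<le> \<alpha>"
    by (subst (asm) mult_le_cancel_left_pos) auto
  ultimately show ?thesis by linarith
qed

end
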